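(* Let $\mathscr D$ be a cyclic symmetric $(v,k,\lambda)$ design and let $p$ be a prime dividing $k-\lambda$ but not dividing $v$. Then $\mathscr D$ is additive under $\mathrm{EA}(p^t)$, where $t=\mathrm{ord}_v(p)$.
   Context: A symmetric $(v,k,\lambda)$ design is a $2$-$(v,k,\lambda)$ design $(V,\mathscr B)$ with as many blocks as points. It is cyclic if there is a cyclic permutation of $V$ (a permutation acting as a single $v$-cycle) leaving $\mathscr B$ invariant. $\mathrm{EA}(p^t)$ denotes the elementary abelian group of order $p^t$ (the additive group of $\mathbb{F}_{p^t}$), and $\mathrm{ord}_v(p)$ is the multiplicative order of $p$ modulo $v$. A design $(V,\mathscr B)$ is additive under an abelian group $G$ if there is an injective map $f:V\to G$ such that $\sum_{x\in B}f(x)=0$ for every block $B\in\mathscr B$. *)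

theory Defs
  imports "HOL-Number_Theory.Number_Theory" "HOL-Library.Multiset"
begin

definition design2 :: "'a set \<Rightarrow> 'a set multiset \<Rightarrow> nat \<Rightarrow> nat \<Rightarrow> nat \<Rightarrow> bool" where
  "design2 V B v k lam \<longleftrightarrow>
     finite V \<and> card V = v \<and>
     (\<forall>b \<in># B. b \<subseteq> V \<and> card b = k) \<and>
     (\<forall>x\<in>V. \<forall>y\<in>V. x \<noteq> y \<longrightarrow> size (filter_mset (\<lambda>b. x \<in> b \<and> y \<in> b) B) = lam)"

definition symmetric_design :: "'a set \<Rightarrow> 'a set multiset \<Rightarrow> nat \<Rightarrow> nat \<Rightarrow> nat \<Rightarrow> bool" where
  "symmetric_design V B v k lam \<longleftrightarrow> design2 V B v k lam \<and> size B = v"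

definition cyclic_design :: "'a set \<Rightarrow> 'a set multiset \<Rightarrow> bool" where
  "cyclic_design V B \<longleftrightarrow>
     (\<exists>\<sigma>. bij_betw \<sigma> V V \<and> (\<exists>x\<in>V. \<forall>y\<in>V. \<exists>n. (\<sigma> ^^ n) x = y) \<and>
          image_mset (\<lambda>b. \<sigma> ` b) B = B)"

text \<open>The elementary abelian group EA(p^t), realised as Z_p^t: vectors
  (functions nat => int supported on {0..<t}) with entries in {0..<p},
  addition componentwise modulo p.\<close>
definition EA_carrier :: "nat \<Rightarrow> nat \<Rightarrow> (nat \<Rightarrow> int) set" where
  "EA_carrier p t = {g. \<forall>i. (i < t \<longrightarrow> 0 \<le> g i \<and> g i < int p) \<and> (t \<le> i \<longrightarrow> g i = 0)}"

definition additive_EA :: "'a set \<Rightarrow> 'a set multiset \<Rightarrow> nat \<Rightarrow> nat \<Rightarrow> bool" where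
  "additive_EA V B p t \<longleftrightarrow>
     (\<exists>f. f ` V \<subseteq> EA_carrier p t \<and> inj_on f V \<and>
          (\<forall>b \<in># B. \<forall>i. (\<Sum>x\<in>b. f x i) mod int p = 0))"

end

theory Submission
  imports Defs "HOL-Computational_Algebra.Polynomial"
begin

text \<open>
  Identify \<open>V\<close> with the integers modulo \<open>v\<close> by means of the given \<open>v\<close>-cycle, and let \<open>\<chi>\<close> be the
  character sending \<open>1\<close> to an element \<open>x\<close> of order \<open>v\<close> in a finite field of characteristic \<open>p\<close>.
  Any two blocks \<open>b\<close>, \<open>b'\<close> meet in \<open>\<lambda>\<close> points modulo \<open>p\<close> (for \<open>b = b'\<close> because \<open>k \<equiv> \<lambda>\<close>), so
  \<open>\<chi>(b) \<chi>\<inverse>(b') = \<Sum>\<^sub>g |b \<inter> (b' + g)| x\<^sup>g = \<lambda> \<Sum>\<^sub>g x\<^sup>g = 0\<close>. Hence \<open>\<chi>\<close> vanishes on all blocks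
  or \<open>\<chi>\<inverse>\<close> does, and the one that does is the required map.

  The field is realised as the polynomial ring \<open>\<int>[x]\<close> modulo a prime ideal \<open>I\<close> containing \<open>p\<close>. To get
  an \<open>I\<close> modulo which \<open>x\<close> has exact order \<open>v\<close>, start from the annihilator of the product of
  \<open>1 - x\<^bsup>v/r\<^esup>\<close>, over the primes \<open>r\<close> dividing \<open>v\<close>, modulo \<open>(p, x\<^sup>v - 1)\<close>. As \<open>x\<close> to the power \<open>p\<^sup>t\<close> is
  \<open>x\<close> modulo \<open>I\<close> for \<open>t = ord\<^sub>v(p)\<close>, every element of the field is a root of \<open>Y\<^sup>q - Y\<close> with
  \<open>q = p\<^sup>t\<close>; hence the dimension over the prime field is at most \<open>t\<close>.
\<close>

section \<open>Ideals in commutative rings\<close>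

locale comm_ideal =
  fixes I :: "'a::comm_ring_1 set"
  assumes zero_mem: "0 \<in> I"
    and add_mem: "a \<in> I \<Longrightarrow> b \<in> I \<Longrightarrow> a + b \<in> I"
    and mult_mem: "a \<in> I \<Longrightarrow> r * a \<in> I"
begin

definition cong_ideal :: "'a \<Rightarrow> 'a \<Rightarrow> bool" (infix "\<approx>" 50) where
  "a \<approx> b \<longleftrightarrow> a - b \<in> I"

lemma mult_mem_right: "a \<in> I \<Longrightarrow> a * r \<in> I"
  using mult_mem[of a r] by (simp add: mult.commute)

lemma uminus_mem: "a \<in> I \<Longrightarrow> - a \<in> I"
  using mult_mem[of a "-1"] by simp

lemma diff_mem: "a \<in> I \<Longrightarrow> b \<in> I \<Longrightarrow> a - b \<in> I"
  using add_mem[of a "-b"] uminus_mem[of b] by simp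

lemma sum_mem: "(\<And>s. s \<in> S \<Longrightarrow> f s \<in> I) \<Longrightarrow> sum f S \<in> I"
  by (induction S rule: infinite_finite_induct) (auto simp: zero_mem add_mem)

lemma cong_ideal_0_iff: "a \<approx> 0 \<longleftrightarrow> a \<in> I"
  by (simp add: cong_ideal_def)

lemma cong_ideal_refl [simp]: "a \<approx> a"
  by (simp add: cong_ideal_def zero_mem)

lemma cong_ideal_sym: "a \<approx> b \<Longrightarrow> b \<approx> a"
  using uminus_mem[of "a - b"] by (simp add: cong_ideal_def)

lemma cong_ideal_trans [trans]: "a \<approx> b \<Longrightarrow> b \<approx> c \<Longrightarrow> a \<approx> c"
  using add_mem[of "a - b" "b - c"] by (simp add: cong_ideal_def)

lemma cong_ideal_mem_iff: "a \<approx> b \<Longrightarrow> a \<in> I \<longleftrightarrow> b \<in> I"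
  by (meson cong_ideal_0_iff cong_ideal_sym cong_ideal_trans)

lemma cong_ideal_add: "a \<approx> b \<Longrightarrow> c \<approx> d \<Longrightarrow> a + c \<approx> b + d"
  using add_mem[of "a - b" "c - d"] by (simp add: cong_ideal_def algebra_simps)

lemma cong_ideal_mult: "a \<approx> b \<Longrightarrow> c \<approx> d \<Longrightarrow> a * c \<approx> b * d"
  using add_mem[OF mult_mem[of "a - b" c] mult_mem[of "c - d" b]]
  by (simp add: cong_ideal_def algebra_simps)

lemma cong_ideal_power: "a \<approx> b \<Longrightarrow> a ^ n \<approx> b ^ n"
  by (induction n) (auto intro: cong_ideal_mult)

lemma cong_ideal_sum: "(\<And>s. s \<in> S \<Longrightarrow> f s \<approx> g s) \<Longrightarrow> sum f S \<approx> sum g S"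
  by (induction S rule: infinite_finite_induct) (auto intro: cong_ideal_add)

lemma of_int_dvd_mem:
  assumes "of_int m \<in> I" and "m dvd n"
  shows "of_int n \<in> I"
  using assms by (auto simp: dvd_def intro: mult_mem_right)

section \<open>The Frobenius map modulo an ideal containing p\<close>

lemma freshmans_dream_cong:
  assumes p: "prime p" and "of_nat p \<in> I"
  shows "(a + b) ^ p \<approx> a ^ p + b ^ p"
proof -
  let ?f = "\<lambda>k. of_nat (p choose k) * a ^ k * b ^ (p - k)"
  have "p > 0" using p by (simp add: prime_gt_0_nat)
  have "(a + b) ^ p = (\<Sum>k\<in>{..p}. ?f k)"
    by (rule binomial_ring)
  also have "{..p} = insert 0 (insert p {0<..<p})"
    using \<open>p > 0\<close> by auto
  also have "(\<Sum>k\<in>\<dots>. ?f k) = b ^ p + (a ^ p + (\<Sum>k\<in>{0<..<p}. ?f k))"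
    using \<open>p > 0\<close> by simp
  also have "\<dots> \<approx> b ^ p + (a ^ p + 0)"
  proof (intro cong_ideal_add cong_ideal_refl)
    have "?f k \<in> I" if "k \<in> {0<..<p}" for k
    proof -
      have "p dvd (p choose k)"
        using that p by (intro dvd_choose_prime) auto
      then obtain m where "p choose k = p * m" ..
      then show ?thesis
        using assms(2) by (auto intro!: mult_mem_right)
    qed
    then show "(\<Sum>k\<in>{0<..<p}. ?f k) \<approx> 0"
      unfolding cong_ideal_0_iff by (rule sum_mem)
  qed
  finally show ?thesis by (simp add: add.commute)
qed

lemma frobenius_power_add:
  assumes "prime p" and "of_nat p \<in> I"
  shows "(a + b) ^ (p ^ n) \<approx> a ^ (p ^ n) + b ^ (p ^ n)"
proof (induction n)
  case (Suc n)
  have "((a + b) ^ (p ^ n)) ^ p \<approx> (a ^ (p ^ n) + b ^ (p ^ n)) ^ p"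
    by (rule cong_ideal_power[OF Suc])
  also have "\<dots> \<approx> (a ^ (p ^ n)) ^ p + (b ^ (p ^ n)) ^ p"
    by (rule freshmans_dream_cong[OF assms])
  finally show ?case by (simp add: mult.commute flip: power_mult)
qed simp

text \<open>Since the power map is additive, it suffices later to check the single terms of a linear
  combination of powers of x.\<close>

lemma frobenius_fixed_sum:
  assumes "prime p" and "of_nat p \<in> I"
    and "\<And>s. s \<in> S \<Longrightarrow> f s ^ (p ^ n) \<approx> f s"
  shows "sum f S ^ (p ^ n) \<approx> sum f S"
  using assms(3)
proof (induction S rule: infinite_finite_induct)
  case (insert s S)
  have "(f s + sum f S) ^ (p ^ n) \<approx> f s ^ (p ^ n) + sum f S ^ (p ^ n)"
    by (rule frobenius_power_add[OF assms(1,2)])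
  also have "\<dots> \<approx> f s + sum f S"
    using insert by (intro cong_ideal_add) auto
  finally show ?case using insert by simp
qed (use assms(1) prime_gt_0_nat[of p] in \<open>simp_all add: power_0_left\<close>)

end

section \<open>Prime ideals: existence, and roots of polynomials modulo them\<close>

locale comm_prime_ideal = comm_ideal +
  assumes one_notin: "1 \<notin> I"
    and prime_mem: "a * b \<in> I \<Longrightarrow> a \<in> I \<or> b \<in> I"

lemma comm_ideal_adjoin:
  assumes "comm_ideal I"
  shows "comm_ideal {u * a + w | u w. w \<in> I}"
proof -
  interpret comm_ideal I by fact
  show ?thesis
  proof
    show "0 \<in> {u * a + w | u w. w \<in> I}"
      using zero_mem by (auto intro!: exI[of _ 0])
  next
    fix b c assume "b \<in> {u * a + w | u w. w \<in> I}" "c \<in> {u * a + w | u w. w \<in> I}"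
    then obtain u w u' w' where
      "b = u * a + w" "w \<in> I" "c = u' * a + w'" "w' \<in> I" by auto
    then have "b + c = (u + u') * a + (w + w')" "w + w' \<in> I"
      by (auto simp: algebra_simps add_mem)
    then show "b + c \<in> {u * a + w | u w. w \<in> I}" by blast
  next
    fix b r assume "b \<in> {u * a + w | u w. w \<in> I}"
    then obtain u w where "b = u * a + w" "w \<in> I" by auto
    then have "r * b = (r * u) * a + r * w" "r * w \<in> I"
      by (auto simp: algebra_simps mult_mem)
    then show "r * b \<in> {u * a + w | u w. w \<in> I}" by blast
  qed
qed

text \<open>Zorn's lemma gives an ideal maximal among those that contain \<open>I\<^sub>0\<close>
  and avoid 1. It is prime because adjoining any outside element to it produces 1.\<close>

lemma ex_prime_ideal_superset:
  assumes "comm_ideal I\<^sub>0" and "1 \<notin> I\<^sub>0"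
  obtains I where "comm_prime_ideal I" and "I\<^sub>0 \<subseteq> I"
proof -
  let ?A = "{I. comm_ideal I \<and> 1 \<notin> I \<and> I\<^sub>0 \<subseteq> I}"
  have "\<exists>M\<in>?A. \<forall>X\<in>?A. M \<subseteq> X \<longrightarrow> X = M"
  proof (rule subset_Zorn_nonempty)
    show "?A \<noteq> {}" using assms by blast
  next
    fix C assume "C \<noteq> {}" and chain: "subset.chain ?A C"
    then have C: "comm_ideal J" "1 \<notin> J" "I\<^sub>0 \<subseteq> J" if "J \<in> C" for J
      using that by (auto simp: subset_chain_def)
    have "comm_ideal (\<Union>C)"
    proof
      show "0 \<in> \<Union>C" using \<open>C \<noteq> {}\<close> C(1) comm_ideal.zero_mem by blast
    next
      fix a b assume "a \<in> \<Union>C" "b \<in> \<Union>C"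
      then obtain J K where JK: "J \<in> C" "K \<in> C" "a \<in> J" "b \<in> K" by blast
      then have "J \<subseteq> K \<or> K \<subseteq> J" using chain by (auto simp: subset_chain_def)
      then show "a + b \<in> \<Union>C"
        using JK C(1) comm_ideal.add_mem by (metis UnionI subsetD)
    next
      fix a r assume "a \<in> \<Union>C"
      then show "r * a \<in> \<Union>C" using C(1) comm_ideal.mult_mem by blast
    qed
    then show "\<Union>C \<in> ?A" using \<open>C \<noteq> {}\<close> C by blast
  qed
  then obtain M where M: "comm_ideal M" "1 \<notin> M" "I\<^sub>0 \<subseteq> M"
    and max: "\<And>X. comm_ideal X \<Longrightarrow> 1 \<notin> X \<Longrightarrow> M \<subseteq> X \<Longrightarrow> X = M"
    by (smt (verit, ccfv_threshold) mem_Collect_eq order_trans)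
  interpret comm_ideal M by fact
  have "comm_prime_ideal M"
  proof
    fix a b assume ab: "a * b \<in> M"
    show "a \<in> M \<or> b \<in> M"
    proof (cases "a \<in> M")
      case False
      let ?X = "{u * a + w | u w. w \<in> M}"
      have "M \<subseteq> ?X" by clarsimp (metis add_0 mult_zero_left)
      moreover have "a \<in> ?X" using zero_mem by clarsimp (metis add_0_right mult_1)
      ultimately have "1 \<in> ?X"
        using max[OF comm_ideal_adjoin[OF M(1)], of a] False by blast
      then obtain u w where "1 = u * a + w" "w \<in> M" by auto
      then have "b = u * (a * b) + w * b" by (metis mult.assoc mult_1 distrib_right)
      then show ?thesis
        using ab \<open>w \<in> M\<close> by (metis add_mem mult_mem mult_mem_right)
    qed simp
  qed (use M in auto)
  then show thesis using M(3) that by blast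
qed

text \<open>Induction on the degree: after a root a is split off by synthetic division, any root b
  incongruent to a is a root of the quotient, since primality cancels b - a. A monic
  \<open>g\<close> has a monic quotient, so the induction continues.\<close>

lemma (in comm_prime_ideal) card_roots_mod_le_degree:
  fixes g :: "'a poly"
  assumes "lead_coeff g = 1" and "finite A"
    and "\<And>a. a \<in> A \<Longrightarrow> poly g a \<in> I"
    and "\<And>a b. a \<in> A \<Longrightarrow> b \<in> A \<Longrightarrow> a \<approx> b \<Longrightarrow> a = b"
  shows "card A \<le> degree g"
  using assms
proof (induction "degree g" arbitrary: g A)
  case 0
  then have "g = 1" by (metis degree_0_id lead_coeff_pCons(1) one_pCons degree_eq_zeroE lead_coeff_pCons)
  then have "A = {}" using 0 one_notin by auto
  then show ?case by simp
next
  case (Suc n)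
  show ?case
  proof (cases "A = {}")
    case False
    then obtain a where a: "a \<in> A" by blast
    define h where "h = synthetic_div g a"
    have g: "g = [:- a, 1:] * h + [:poly g a:]"
      unfolding h_def by (rule synthetic_div_correct'[symmetric])
    have dh: "degree h = n" using Suc(2) by (simp add: h_def degree_synthetic_div)
    have "coeff g (Suc n) = coeff h n + (- a * coeff h (Suc n))"
      by (subst g) simp
    then have "lead_coeff h = 1"
      using Suc(2,3) dh by (simp add: coeff_eq_0)
    moreover have "poly h b \<in> I" if "b \<in> A - {a}" for b
    proof -
      have "poly g b = (b - a) * poly h b + poly g a"
        by (subst g) (simp add: algebra_simps)
      then have "(b - a) * poly h b \<in> I"
        using Suc(5) that a diff_mem by (metis DiffD1 add_diff_cancel_right')
      moreover have "b - a \<notin> I"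
        using Suc(6)[of b a] that a by (auto simp: cong_ideal_def)
      ultimately show ?thesis using prime_mem by blast
    qed
    ultimately have "card (A - {a}) \<le> n"
      using Suc(1)[of h "A - {a}"] dh Suc(4,6) by auto
    then show ?thesis using a Suc(2,4) by (simp add: card_Diff_singleton)
  qed simp
qed

section \<open>Coordinates of the powers of x over the prime field\<close>

context comm_prime_ideal
begin

text \<open>Fermat's little theorem, from writing n as a sum of n ones.\<close>

lemma of_nat_frobenius_fixed:
  assumes "prime p" and "of_nat p \<in> I"
  shows "of_nat n ^ (p ^ t) \<approx> of_nat n"
  using frobenius_fixed_sum[OF assms, of "{..<n}" "\<lambda>_. 1" t] by simp

text \<open>These coordinates become the values of the additive map. The bound
  \<open>d \<le> t\<close> is a count: the p^d combinations with digits below p are pairwise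
  incongruent roots of Y^(p^t) - Y.\<close>

lemma power_coordinates:
  fixes x :: 'a
  assumes p: "prime p" "of_nat p \<in> I" and v: "v > 0" "x ^ v \<approx> 1"
    and t: "t > 0" "x ^ (p ^ t) \<approx> x"
  obtains d c where "d \<le> t" and "\<And>n. c n \<in> EA_carrier p d"
    and "\<And>n. x ^ n \<approx> (\<Sum>i<d. of_int (c n i) * x ^ i)"
    and "\<And>e i. (\<Sum>i<d. of_int (e i) * x ^ i) \<in> I \<Longrightarrow> i < d \<Longrightarrow> int p dvd e i"
proof -
  define L where "L d e = (\<Sum>i<d. of_int (e i) * x ^ i)" for d and e :: "nat \<Rightarrow> int"
  define dep where "dep d \<longleftrightarrow> (\<exists>e. x ^ d \<approx> L d e)" for d
  \<comment> \<open>With this \<open>d\<close> the powers \<open>x\<^sup>i\<close>, \<open>i < d\<close>, form a basis of \<open>\<int>[x]\<close> modulo \<open>I\<close> over the prime field.\<close>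
  define d where "d = (LEAST d. dep d)"
  \<comment> \<open>Modulo \<open>I\<close>, x^v equals x^0, a combination of lower powers; so
    \<open>dep\<close> holds for v and a least \<open>d\<close> exists.\<close>
  have "L v (\<lambda>i. if i = 0 then 1 else 0) = (\<Sum>i<v. if i = 0 then 1 else 0)"
    unfolding L_def by (intro sum.cong) auto
  then have "dep v"
    using v by (auto simp: dep_def intro!: exI[of _ "\<lambda>i. if i = 0 then 1 else 0"])
  then have "dep d" unfolding d_def by (rule LeastI)
  then obtain c\<^sub>0 where c\<^sub>0: "x ^ d \<approx> L d c\<^sub>0" by (auto simp: dep_def)
  have "d \<noteq> 0"
  proof
    assume "d = 0"
    then have "1 \<approx> 0" using c\<^sub>0 by (simp add: L_def)
    then show False using one_notin cong_ideal_0_iff by blast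
  qed
  then obtain d' where d': "d = Suc d'" using not0_implies_Suc by blast

  have p_mem: "of_int m \<in> I" if "int p dvd m" for m
    using of_int_dvd_mem[of "int p" m] p(2) that by simp
  have of_int_cong: "of_int m \<approx> of_int n" if "int p dvd m - n" for m n
    using p_mem[OF that] by (simp add: cong_ideal_def)
  \<comment> \<open>In a relation with a coefficient prime to p, take the highest such index m.
    Inverting that coefficient modulo p expresses x^m by lower powers, against the minimality of
    \<open>d\<close>.\<close>
  have indep: "int p dvd e i" if "L d e \<in> I" "i < d" for e i
  proof (rule ccontr)
    assume "\<not> int p dvd e i"
    let ?S = "{i. i < d \<and> \<not> int p dvd e i}"
    define m where "m = Max ?S"
    have "m \<in> ?S"
      unfolding m_def using \<open>i < d\<close> \<open>\<not> int p dvd e i\<close> by (intro Max_in) auto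
    then have m: "m < d" "\<not> int p dvd e m" by auto
    have above: "int p dvd e j" if "m < j" "j < d" for j
    proof (rule ccontr)
      assume "\<not> int p dvd e j"
      then have "j \<le> m" unfolding m_def using that by (intro Max_ge) auto
      then show False using that by simp
    qed
    have "L d e = L (Suc m) e + (\<Sum>j\<in>{Suc m..<d}. of_int (e j) * x ^ j)"
      using m(1) by (simp add: L_def lessThan_atLeast0 sum.atLeastLessThan_concat del: sum.op_ivl_Suc)
    moreover have "(\<Sum>j\<in>{Suc m..<d}. of_int (e j) * x ^ j) \<in> I"
      using above by (intro sum_mem mult_mem_right p_mem) auto
    ultimately have mem: "L (Suc m) e \<in> I"
      using \<open>L d e \<in> I\<close> by (metis add_diff_cancel_right' diff_mem)
    have "coprime (e m) (int p)"
      using m(2) p(1) by (metis coprime_commute prime_imp_coprime prime_int_nat_transfer prime_nat_int_transfer)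
    then obtain u where "[e m * u = 1] (mod int p)"
      using cong_solve_coprime_int by blast
    then have "of_int (e m * u) \<approx> of_int 1"
      by (intro of_int_cong) (simp add: cong_iff_dvd_diff)
    then have "x ^ m \<approx> of_int (e m * u) * x ^ m"
      by (metis cong_ideal_mult cong_ideal_refl cong_ideal_sym mult_1 of_int_1)
    also have "\<dots> = L m (\<lambda>i. - u * e i) + of_int u * L (Suc m) e"
      by (simp add: L_def sum_distrib_left sum_negf algebra_simps)
    also have "\<dots> \<approx> L m (\<lambda>i. - u * e i) + 0"
      using mem by (intro cong_ideal_add cong_ideal_refl) (simp add: cong_ideal_0_iff mult_mem)
    finally have "dep m" by (auto simp: dep_def)
    then show False using not_less_Least m(1) d_def by blast
  qed

  \<comment> \<open>Multiplication by x shifts the coefficients, and the overflow at x^d is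
    rewritten by means of \<open>c\<^sub>0\<close>.\<close>
  have "\<exists>e. x ^ n \<approx> L d e" for n
  proof (induction n)
    case 0
    have "L d (\<lambda>i. if i = 0 then 1 else 0) = 1"
      unfolding d' L_def sum.lessThan_Suc_shift by simp
    then show ?case by (metis cong_ideal_refl power_0)
  next
    case (Suc n)
    then obtain e where "x ^ n \<approx> L d e" by blast
    then have "x ^ Suc n \<approx> x * L d e" by (simp add: cong_ideal_mult)
    also have "x * L d e = (\<Sum>i<d'. of_int (e i) * x ^ Suc i) + of_int (e d') * x ^ d"
      by (simp add: d' L_def sum_distrib_left algebra_simps)
    also have "\<dots> \<approx> (\<Sum>i<d'. of_int (e i) * x ^ Suc i) + of_int (e d') * L d c\<^sub>0"
      using c\<^sub>0 by (intro cong_ideal_add cong_ideal_mult) auto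
    also have "(\<Sum>i<d'. of_int (e i) * x ^ Suc i) = L d (\<lambda>i. if i = 0 then 0 else e (i - 1))"
      unfolding d' L_def sum.lessThan_Suc_shift by simp
    also have "\<dots> + of_int (e d') * L d c\<^sub>0 =
        L d (\<lambda>i. (if i = 0 then 0 else e (i - 1)) + e d' * c\<^sub>0 i)"
      by (simp add: L_def sum_distrib_left sum.distrib algebra_simps)
    finally show ?case by blast
  qed
  then obtain e where e: "\<And>n. x ^ n \<approx> L d (e n)" by metis
  \<comment> \<open>Digits reduced modulo p, and 0 from index d on, as \<open>EA_carrier\<close>
    demands.\<close>
  define c where "c n i = (if i < d then e n i mod int p else 0)" for n i
  have p_pos: "int p > 0" using p(1) by (simp add: prime_gt_0_nat)
  have "L d (e n) \<approx> L d (c n)" for n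
    unfolding L_def c_def
    by (intro cong_ideal_sum cong_ideal_mult of_int_cong) (auto simp: minus_mod_eq_mult_div)
  then have c: "x ^ n \<approx> L d (c n)" for n
    using e cong_ideal_trans by blast
  have c_carrier: "c n \<in> EA_carrier p d" for n
    using p_pos by (auto simp: EA_carrier_def c_def)

  have "d \<le> t"
  proof -
    let ?E = "{..<d} \<rightarrow>\<^sub>E {0..<int p}"
    have ext: "e = e'" if "e \<in> ?E" "e' \<in> ?E" "L d e \<approx> L d e'" for e e'
    proof (rule PiE_ext[OF that(1,2)])
      fix i assume i: "i \<in> {..<d}"
      have "L d (\<lambda>i. e i - e' i) = L d e - L d e'"
        by (simp add: L_def sum_subtractf algebra_simps)
      then have "int p dvd e i - e' i"
        using that(3) i indep[of "\<lambda>i. e i - e' i"] by (simp add: cong_ideal_def)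
      moreover have "e i \<in> {0..<int p}" "e' i \<in> {0..<int p}"
        using PiE_mem[OF that(1) i] PiE_mem[OF that(2) i] .
      ultimately show "e i = e' i"
        by (metis atLeastLessThan_iff mod_eq_dvd_iff mod_pos_pos_trivial)
    qed
    define A where "A = L d ` ?E"
    define g :: "'a poly" where "g = monom 1 (p ^ t) - monom 1 1"
    have "p ^ t > 1"
      using p(1) t(1) by (metis one_less_power prime_gt_1_nat)
    have "degree g = p ^ t"
    proof (rule antisym)
      show "degree g \<le> p ^ t"
        unfolding g_def using \<open>p ^ t > 1\<close>
        by (intro degree_diff_le order_trans[OF degree_monom_le]) auto
      have "coeff g (p ^ t) \<noteq> 0" using \<open>p ^ t > 1\<close> by (simp add: g_def)
      then show "p ^ t \<le> degree g" by (rule le_degree)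
    qed
    moreover have "coeff g (p ^ t) = 1" using \<open>p ^ t > 1\<close> by (simp add: g_def)
    moreover have "poly g a \<in> I" if "a \<in> A" for a
    proof -
      from that obtain e where e: "e \<in> ?E" "a = L d e" by (auto simp: A_def)
      have "(of_int (e i) * x ^ i) ^ (p ^ t) \<approx> of_int (e i) * x ^ i" if "i < d" for i
      proof -
        have "e i \<ge> 0" using PiE_mem[OF e(1)] that by auto
        then have "of_int (e i) = (of_nat (nat (e i)) :: 'a)" by simp
        then have "(of_int (e i) :: 'a) ^ (p ^ t) \<approx> of_int (e i)"
          using of_nat_frobenius_fixed[OF p] by metis
        moreover have "(x ^ i) ^ (p ^ t) \<approx> x ^ i"
          using cong_ideal_power[OF t(2), of i] by (simp add: mult.commute flip: power_mult)
        ultimately show ?thesis by (simp add: power_mult_distrib cong_ideal_mult)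
      qed
      then have "a ^ (p ^ t) \<approx> a"
        unfolding e(2) L_def by (intro frobenius_fixed_sum[OF p]) auto
      then show ?thesis by (simp add: g_def poly_monom cong_ideal_def)
    qed
    moreover have "finite A" by (simp add: A_def finite_PiE)
    moreover have "a = b" if "a \<in> A" "b \<in> A" "a \<approx> b" for a b
      using that ext unfolding A_def by blast
    ultimately have "card A \<le> p ^ t"
      using card_roots_mod_le_degree[of g A] by simp
    moreover have "card A = p ^ d"
    proof -
      have "inj_on (L d) ?E" using ext by (intro inj_onI) (metis cong_ideal_refl)
      then show ?thesis by (simp add: A_def card_image card_PiE)
    qed
    ultimately show ?thesis
      using power_increasing_iff[OF prime_gt_1_nat[OF p(1)]] by simp
  qed
  then show thesis using that c_carrier c indep unfolding L_def by blast
qed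

end

section \<open>A prime ideal modulo which \<open>x\<close> has order \<open>v\<close>\<close>

text \<open>Dividing v by a prime s other than r loses no factor r, so r^a divides each
  \<open>v div s\<close> and hence every exponent of the expanded product.\<close>

lemma coeff_prime_factor_prod_dvd:
  fixes v r :: nat
  assumes "finite S" and "\<And>s. s \<in> S \<Longrightarrow> prime s \<and> s dvd v"
    and "prime r" "r \<notin> S" and "r ^ a dvd v"
    and "coeff (\<Prod>s\<in>S. 1 - monom (1::int) (v div s)) n \<noteq> 0"
  shows "r ^ a dvd n"
  using assms(1,2,4,6)
proof (induction S arbitrary: n rule: finite_induct)
  case empty
  then show ?case by (auto split: if_splits)
next
  case (insert s S)
  let ?f = "\<Prod>s\<in>S. 1 - monom (1::int) (v div s)"
  have s: "prime s" "s dvd v" "r \<noteq> s" using insert.prems by auto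
  have "coprime (r ^ a) s"
    using s \<open>prime r\<close> by (simp add: primes_coprime)
  moreover have "r ^ a dvd s * (v div s)"
    using \<open>r ^ a dvd v\<close> s by simp
  ultimately have e: "r ^ a dvd v div s"
    by (simp add: coprime_dvd_mult_right_iff)
  have IH: "r ^ a dvd m" if "coeff ?f m \<noteq> 0" for m
    using insert.IH[of m] insert.prems that by auto
  have "coeff ?f n - coeff (monom 1 (v div s) * ?f) n \<noteq> 0"
    using insert by (simp add: algebra_simps)
  then have "coeff ?f n \<noteq> 0 \<or> v div s \<le> n \<and> coeff ?f (n - v div s) \<noteq> 0"
    by (auto simp: coeff_monom_mult split: if_splits)
  then show ?case using IH e by (metis dvd_diffD)
qed

text \<open>The new factor at r shifts exponents by \<open>v div r\<close>, which lacks one factor r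
  of v, while the old exponents have the full power of r. So a shifted exponent is never a multiple
  of v.\<close>

lemma coeff_prime_factor_prod_multiple:
  fixes v :: nat
  assumes "v > 0" and "finite S" and "\<And>s. s \<in> S \<Longrightarrow> prime s \<and> s dvd v" and "v dvd n"
  shows "coeff (\<Prod>s\<in>S. 1 - monom (1::int) (v div s)) n = coeff 1 n"
  using assms(2,3)
proof (induction S rule: finite_induct)
  case (insert r S)
  let ?f = "\<Prod>s\<in>S. 1 - monom (1::int) (v div s)"
  have r: "prime r" "r dvd v" using insert.prems by auto
  define a where "a = multiplicity r v"
  have "coeff (monom 1 (v div r) * ?f) n = 0"
  proof (rule ccontr)
    assume "coeff (monom 1 (v div r) * ?f) n \<noteq> 0"
    then have le: "v div r \<le> n" and nz: "coeff ?f (n - v div r) \<noteq> 0"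
      by (auto simp: coeff_monom_mult split: if_splits)
    have "r ^ a dvd v" by (simp add: a_def multiplicity_dvd)
    then have "r ^ a dvd n - v div r"
      using coeff_prime_factor_prod_dvd[OF insert.hyps(1) _ r(1) insert.hyps(2) _ nz] insert.prems
      by auto
    moreover have "r ^ a dvd n" using \<open>r ^ a dvd v\<close> \<open>v dvd n\<close> by (rule dvd_trans)
    ultimately have "r ^ a dvd v div r" using le by (metis dvd_diffD1)
    then have "r ^ Suc a dvd v"
      using r by (metis dvd_div_mult_self mult_dvd_mono dvd_refl power_Suc2)
    then show False
      using r \<open>v > 0\<close> unfolding a_def
      by (metis multiplicity_geI not_prime_unit lessI not_less not_gr_zero)
  qed
  then show ?case using insert by (simp add: algebra_simps)
qed simp

text \<open>Multiplication by x^v moves the coefficient at v * m to v * (m + 1), so the sum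
  telescopes to a boundary term.\<close>

lemma sum_coeff_multiples_X_pow_minus_one:
  assumes "v > 0"
  shows "(\<Sum>m\<le>M. coeff ((monom 1 v - 1) * g) (v * m)) = - coeff (g :: 'a::comm_ring_1 poly) (v * M)"
proof (induction M)
  case 0
  then show ?case using assms by (simp add: left_diff_distrib coeff_monom_mult)
next
  case (Suc M)
  have "coeff ((monom 1 v - 1) * g) (v * Suc M) = coeff g (v * M) - coeff g (v * Suc M)"
    by (simp add: left_diff_distrib coeff_monom_mult)
  then show ?case using Suc by simp
qed

text \<open>The sum of the coefficients at multiples of \<open>v\<close> is a functional that kills the multiples of
  \<open>x\<^sup>v - 1\<close> but takes the value 1 on the product.\<close>
lemma prime_factor_prod_notin:
  fixes v p :: nat
  assumes "v > 0" and "prime p"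
  shows "(\<Prod>s\<in>prime_factors v. 1 - monom (1::int) (v div s)) \<noteq> of_nat p * h + (monom 1 v - 1) * g"
proof
  assume eq: "(\<Prod>s\<in>prime_factors v. 1 - monom (1::int) (v div s)) = of_nat p * h + (monom 1 v - 1) * g"
  \<comment> \<open>Beyond the degree of \<open>g\<close> the boundary term of the telescoping sum
    is 0.\<close>
  define M where "M = Suc (degree g)"
  have "M \<le> v * M" using \<open>v > 0\<close> by simp
  then have "coeff g (v * M) = 0" by (intro coeff_eq_0) (simp add: M_def)
  have "1 = (\<Sum>m\<le>M. coeff (1 :: int poly) (v * m))"
    using \<open>v > 0\<close> by simp
  also have "\<dots> = (\<Sum>m\<le>M. coeff (\<Prod>s\<in>prime_factors v. 1 - monom (1::int) (v div s)) (v * m))"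
    using \<open>v > 0\<close> by (intro sum.cong coeff_prime_factor_prod_multiple[symmetric]) auto
  also have "\<dots> = (\<Sum>m\<le>M. int p * coeff h (v * m)) + (\<Sum>m\<le>M. coeff ((monom 1 v - 1) * g) (v * m))"
    unfolding eq by (simp add: sum.distrib of_nat_poly)
  also have "\<dots> = int p * (\<Sum>m\<le>M. coeff h (v * m))"
    using \<open>coeff g (v * M) = 0\<close> sum_coeff_multiples_X_pow_minus_one[OF \<open>v > 0\<close>, where g = g and M = M]
    by (simp add: sum_distrib_left)
  finally have "int p dvd 1" by (metis dvd_triv_left)
  then show False using \<open>prime p\<close> by simp
qed

context comm_ideal
begin

text \<open>Bezout in the form i * a = j * b + gcd i j, which keeps all exponents natural.\<close>

lemma power_cong_1_gcd:
  assumes "x ^ i \<approx> 1" and "x ^ j \<approx> 1" and "i > 0"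
  shows "x ^ gcd i j \<approx> 1"
proof -
  obtain a b where ab: "i * a = j * b + gcd i j"
    using bezout_nat[of i j] \<open>i > 0\<close> by auto
  have one: "x ^ (k * m) \<approx> 1" if "x ^ k \<approx> 1" for k m
    using cong_ideal_power[OF that, of m] by (simp add: power_mult)
  have "1 \<approx> x ^ (j * b + gcd i j)"
    using one[OF assms(1), of a] ab by (simp add: cong_ideal_sym)
  also have "\<dots> \<approx> 1 * x ^ gcd i j"
    unfolding power_add by (intro cong_ideal_mult one assms(2)) simp
  finally show ?thesis by (simp add: cong_ideal_sym)
qed

end

text \<open>Modulo \<open>x ^ (v div r) - 1\<close> the sum in the last assumption is \<open>r\<close>, which is a unit
  modulo \<open>p\<close>; this is why \<open>x\<close> has exact order \<open>v\<close>.\<close>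
lemma (in comm_prime_ideal) power_cong_1_iff_dvd:
  assumes v: "v > 0" and p: "prime p" "\<not> p dvd v" "of_nat p \<in> I" and xv: "x ^ v \<approx> 1"
    and N: "\<And>r. prime r \<Longrightarrow> r dvd v \<Longrightarrow> (\<Sum>j<r. (x ^ (v div r)) ^ j) \<in> I"
  shows "x ^ i \<approx> 1 \<longleftrightarrow> v dvd i"
proof
  assume "v dvd i"
  then obtain k where "i = v * k" ..
  then show "x ^ i \<approx> 1" using cong_ideal_power[OF xv, of k] by (simp add: power_mult)
next
  assume xi: "x ^ i \<approx> 1"
  show "v dvd i"
  proof (rule ccontr)
    assume nd: "\<not> v dvd i"
    then have "i > 0" by (auto intro: Nat.gr0I)
    \<comment> \<open>Here \<open>g\<close> is a proper divisor of v. For a prime r dividing v / g,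
      also \<open>v div r\<close> is a multiple of \<open>g\<close>, so x^(v div r) is already 1
      modulo \<open>I\<close>.\<close>
    define g where "g = gcd i v"
    have g1: "x ^ g \<approx> 1" unfolding g_def using power_cong_1_gcd[OF xi xv \<open>i > 0\<close>] .
    obtain m where m: "v = g * m" unfolding g_def by (metis dvdE gcd_dvd2)
    have "m \<noteq> 1" using nd m unfolding g_def by (metis gcd_dvd1 mult.right_neutral)
    then obtain r k where r: "prime r" "m = r * k" by (metis prime_factor_nat dvdE)
    then have "v div r = g * k" using m by (simp add: prime_gt_0_nat)
    then have "x ^ (v div r) \<approx> 1"
      using cong_ideal_power[OF g1, of k] by (simp add: power_mult)
    then have "(\<Sum>j<r. (x ^ (v div r)) ^ j) \<approx> (\<Sum>j<r. 1)"
      by (intro cong_ideal_sum) (metis cong_ideal_power power_one)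
    then have "of_nat r \<in> I" using cong_ideal_mem_iff N[OF r(1)] m r(2) by simp
    moreover have "coprime r p" using r m p by (metis primes_coprime dvd_triv_left dvd_mult)
    then have "gcd (int r) (int p) = 1" by simp
    then obtain a b where "a * int r + b * int p = 1"
      using bezout_int[of "int r" "int p"] by auto
    then have "of_int a * of_nat r + of_int b * of_nat p = (1 :: 'a)"
      by (metis of_int_1 of_int_add of_int_mult of_int_of_nat_eq)
    ultimately show False
      using one_notin p(3) by (metis add_mem mult_mem)
  qed
qed

text \<open>Any prime ideal above the annihilator \<open>I\<^sub>0\<close> of \<open>T\<close> will
  do. That \<open>I\<^sub>0\<close> is proper means that \<open>T\<close> does not lie in the ideal
  generated by p and x^v - 1.\<close>

lemma ex_prime_ideal_primitive_root:
  fixes v p :: nat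
  assumes v: "v > 0" and p: "prime p" "\<not> p dvd v"
  obtains I and x :: "int poly" where "comm_prime_ideal I" and "of_nat p \<in> I"
    and "\<And>i. x ^ i - 1 \<in> I \<longleftrightarrow> v dvd i"
proof -
  define T where "T = (\<Prod>s\<in>prime_factors v. 1 - monom (1::int) (v div s))"
  define I\<^sub>0 where "I\<^sub>0 = {f. \<exists>h g. T * f = of_nat p * h + (monom 1 v - 1) * g}"
  have "comm_ideal I\<^sub>0"
  proof
    show "0 \<in> I\<^sub>0" by (auto simp: I\<^sub>0_def intro!: exI[of _ 0])
  next
    fix a b assume "a \<in> I\<^sub>0" "b \<in> I\<^sub>0"
    then obtain h g h' g' where "T * a = of_nat p * h + (monom 1 v - 1) * g"
      "T * b = of_nat p * h' + (monom 1 v - 1) * g'" by (auto simp: I\<^sub>0_def)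
    then have "T * (a + b) = of_nat p * (h + h') + (monom 1 v - 1) * (g + g')"
      by (simp add: algebra_simps)
    then show "a + b \<in> I\<^sub>0" unfolding I\<^sub>0_def by blast
  next
    fix a r assume "a \<in> I\<^sub>0"
    then obtain h g where "T * a = of_nat p * h + (monom 1 v - 1) * g"
      by (auto simp: I\<^sub>0_def)
    then have "T * (r * a) = of_nat p * (r * h) + (monom 1 v - 1) * (r * g)"
      by (metis (no_types, lifting) distrib_left mult.left_commute)
    then show "r * a \<in> I\<^sub>0" unfolding I\<^sub>0_def by blast
  qed
  moreover have "1 \<notin> I\<^sub>0"
    using prime_factor_prod_notin[OF v p(1)] by (simp add: I\<^sub>0_def T_def)
  ultimately obtain I where "comm_prime_ideal I" and sub: "I\<^sub>0 \<subseteq> I"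
    by (rule ex_prime_ideal_superset)
  interpret comm_prime_ideal I by fact
  define x :: "int poly" where "x = monom 1 1"
  have x_pow: "x ^ n = monom 1 n" for n
    by (simp add: x_def monom_power)
  have "T * of_nat p = of_nat p * T + (monom 1 v - 1) * 0" by (simp add: mult.commute)
  then have "of_nat p \<in> I\<^sub>0" unfolding I\<^sub>0_def by blast
  then have p_mem: "of_nat p \<in> I" using sub by blast
  have "T * (x ^ v - 1) = of_nat p * 0 + (monom 1 v - 1) * T" by (simp add: x_pow)
  then have "x ^ v - 1 \<in> I\<^sub>0" unfolding I\<^sub>0_def by blast
  then have xv: "cong_ideal (x ^ v) 1" using sub by (auto simp: cong_ideal_def)
  \<comment> \<open>The factor of \<open>T\<close> at r times this sum is 1 - x^v, so the sum
    annihilates \<open>T\<close>.\<close>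
  have N: "(\<Sum>j<r. (x ^ (v div r)) ^ j) \<in> I" if r: "prime r" "r dvd v" for r
  proof -
    define N where "N = (\<Sum>j<r. (x ^ (v div r)) ^ j)"
    have r_in: "r \<in> prime_factors v" using r v by (simp add: in_prime_factors_iff)
    define T' where "T' = (\<Prod>s\<in>prime_factors v - {r}. 1 - monom (1::int) (v div s))"
    have T: "T = (1 - x ^ (v div r)) * T'"
      unfolding T_def T'_def x_pow using r_in by (simp add: prod.remove)
    have "(1 - x ^ (v div r)) * N = 1 - (x ^ (v div r)) ^ r"
      unfolding N_def by (rule one_diff_power_eq[symmetric])
    also have "\<dots> = 1 - x ^ v" using r(2) by (simp flip: power_mult)
    finally have "(1 - x ^ (v div r)) * N = 1 - x ^ v" .
    then have "T * N = (1 - x ^ v) * T'"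
      unfolding T by (metis mult.assoc mult.commute)
    then have "T * N = of_nat p * 0 + (monom 1 v - 1) * (- T')"
      by (simp add: x_pow algebra_simps)
    then have "N \<in> I\<^sub>0" unfolding I\<^sub>0_def by blast
    then show ?thesis unfolding N_def using sub by blast
  qed
  show thesis
    using that[OF \<open>comm_prime_ideal I\<close> p_mem, of x] power_cong_1_iff_dvd[OF v p p_mem xv N]
    by (simp add: cong_ideal_def)
qed

section \<open>Symmetric designs and their cyclic structure\<close>

text \<open>After computing the constant row sum \<open>k\<close>, the inner products \<open>X j\<close> of column \<open>i\<close> with the
  other columns have \<open>\<Sum>\<^sub>j (X j - lam)\<^sup>2 = 0\<close>.\<close>
lemma incidence_columns_inner_product:
  fixes a :: "'x \<Rightarrow> 'j \<Rightarrow> int"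
  assumes fin: "finite V" "finite J" and card: "card V = v" "card J = v"
    and idem: "\<And>x j. a x j * a x j = a x j"
    and col: "\<And>j. j \<in> J \<Longrightarrow> (\<Sum>x\<in>V. a x j) = k"
    and row: "\<And>x y. x \<in> V \<Longrightarrow> y \<in> V \<Longrightarrow> x \<noteq> y \<Longrightarrow> (\<Sum>j\<in>J. a x j * a y j) = lam"
    and k: "k \<noteq> 1"
    and ij: "i \<in> J" "j \<in> J" "i \<noteq> j"
  shows "(\<Sum>x\<in>V. a x i * a x j) = lam"
proof -
  have "v > 0" using ij(1) fin(2) card(2) by (auto simp: card_gt_0_iff)
  define r where "r x = (\<Sum>j\<in>J. a x j)" for x
  have rows: "(\<Sum>j\<in>J. a x j * a y j) = (if x = y then r x else lam)" if "x \<in> V" "y \<in> V" for x y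
    using row[OF that] by (auto simp: r_def idem)
  have row_sum: "(\<Sum>y\<in>V. b y * (if x = y then r x else lam)) = b x * r x + ((\<Sum>y\<in>V. b y) - b x) * lam"
    if "x \<in> V" for x and b :: "'x \<Rightarrow> int"
  proof -
    have "(\<Sum>y\<in>V - {x}. b y * (if x = y then r x else lam)) = (\<Sum>y\<in>V - {x}. b y) * lam"
      unfolding sum_distrib_right by (intro sum.cong) auto
    then show ?thesis
      using that fin(1) by (simp add: sum.remove[of V x])
  qed
  \<comment> \<open>Count pairs (y, j) with x and y both in column j: each of the \<open>r x\<close>
    columns through x has k points y; conversely y = x occurs \<open>r x\<close> times and every
    other y occurs lam times.\<close>
  have r_eq: "(k - 1) * r x = (int v - 1) * lam" if "x \<in> V" for x
  proof -
    have "k * r x = (\<Sum>j\<in>J. a x j * (\<Sum>y\<in>V. a y j))"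
      by (simp add: col r_def sum_distrib_left mult.commute)
    also have "\<dots> = (\<Sum>y\<in>V. \<Sum>j\<in>J. a x j * a y j)"
      unfolding sum_distrib_left by (rule sum.swap)
    also have "\<dots> = (\<Sum>y\<in>V. 1 * (if x = y then r x else lam))"
      using that by (intro sum.cong) (auto simp: rows)
    also have "\<dots> = r x + (int v - 1) * lam"
      unfolding row_sum[OF that] by (simp add: card(1))
    finally show ?thesis by (simp add: algebra_simps)
  qed
  \<comment> \<open>There are v * k incidences in all. Summing the previous identity over x and
    cancelling v gives k (k - 1) = (v - 1) lam; comparing with that identity, k - 1 cancels and
    every row sum is k.\<close>
  have "(\<Sum>x\<in>V. r x) = (\<Sum>j\<in>J. \<Sum>x\<in>V. a x j)"
    unfolding r_def by (rule sum.swap)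
  then have "int v * ((k - 1) * k) = (k - 1) * (\<Sum>x\<in>V. r x)" by (simp add: col card(2))
  also have "\<dots> = (\<Sum>x\<in>V. (k - 1) * r x)" by (rule sum_distrib_left)
  also have "\<dots> = int v * ((int v - 1) * lam)" by (simp add: r_eq card(1))
  finally have "int v * ((k - 1) * k) = int v * ((int v - 1) * lam)" .
  then have k_lam: "(k - 1) * k = (int v - 1) * lam" using \<open>v > 0\<close> by simp
  have r: "r x = k" if "x \<in> V" for x
    using r_eq[OF that] k_lam k by (metis mult_cancel_left eq_iff_diff_eq_0)

  define X where "X j = (\<Sum>x\<in>V. a x i * a x j)" for j
  have Xi: "X i = k" using col ij(1) by (simp add: X_def idem)
  have "(\<Sum>j\<in>J. X j) = (\<Sum>x\<in>V. a x i * r x)"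
    unfolding X_def r_def sum_distrib_left by (rule sum.swap)
  also have "\<dots> = k * k"
    by (simp add: r sum_distrib_right[symmetric] col ij(1))
  finally have X1: "(\<Sum>j\<in>J. X j) = k * k" .
  \<comment> \<open>Squaring gives a sum over pairs of rows; summing over j first turns each pair
    into a known row product.\<close>
  have "(\<Sum>j\<in>J. X j * X j) = (\<Sum>j\<in>J. \<Sum>x\<in>V. \<Sum>y\<in>V. a x i * a y i * (a x j * a y j))"
    unfolding X_def sum_product by (simp add: mult_ac)
  also have "\<dots> = (\<Sum>x\<in>V. \<Sum>y\<in>V. \<Sum>j\<in>J. a x i * a y i * (a x j * a y j))"
    by (subst sum.swap, intro sum.cong refl) (rule sum.swap)
  also have "\<dots> = (\<Sum>x\<in>V. a x i * (\<Sum>y\<in>V. a y i * (if x = y then r x else lam)))"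
    unfolding sum_distrib_left
    by (intro sum.cong refl) (simp add: rows sum_distrib_left[symmetric] mult.assoc)
  also have "\<dots> = (\<Sum>x\<in>V. a x i * (k + (k - 1) * lam))"
  proof (intro sum.cong refl)
    fix x assume x: "x \<in> V"
    have "a x i * (a x i * k + (k - a x i) * lam) =
        (a x i * a x i) * k + a x i * k * lam - (a x i * a x i) * lam"
      by (simp add: algebra_simps)
    then show "a x i * (\<Sum>y\<in>V. a y i * (if x = y then r x else lam)) = a x i * (k + (k - 1) * lam)"
      unfolding row_sum[OF x, of "\<lambda>y. a y i"] using r[OF x] col[OF ij(1)]
      by (simp add: idem algebra_simps)
  qed
  also have "\<dots> = k * (k + (k - 1) * lam)"
    by (simp only: sum_distrib_right[symmetric] col[OF ij(1)])
  finally have X2: "(\<Sum>j\<in>J. X j * X j) = k * (k + (k - 1) * lam)" .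

  \<comment> \<open>The full sum of squares comes out equal to its term at j = i, so the remaining
    nonnegative terms are 0.\<close>
  have "(\<Sum>j\<in>J. (X j - lam)\<^sup>2) = (\<Sum>j\<in>J. X j * X j) - 2 * lam * (\<Sum>j\<in>J. X j) + int v * lam\<^sup>2"
    by (simp add: power2_diff sum.distrib sum_subtractf sum_distrib_left card(2))
       (simp add: power2_eq_square mult_ac)
  also have "\<dots> = k\<^sup>2 - 2 * lam * k + lam\<^sup>2 - lam * ((k - 1) * k) + lam * ((int v - 1) * lam)"
    unfolding X1 X2 by (simp add: power2_eq_square algebra_simps)
  also have "\<dots> = (X i - lam)\<^sup>2"
    unfolding k_lam Xi by (simp add: power2_eq_square algebra_simps)
  finally have "(\<Sum>j\<in>J - {i}. (X j - lam)\<^sup>2) = 0"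
    using sum.remove[OF fin(2) ij(1), of "\<lambda>j. (X j - lam)\<^sup>2"] by simp
  then have "(X j - lam)\<^sup>2 = 0"
    using ij fin(2) by (subst (asm) sum_nonneg_eq_0_iff) auto
  then show ?thesis by (simp add: X_def)
qed

lemma symmetric_design_block_inter:
  assumes sym: "symmetric_design V B v k lam" and k: "k \<noteq> 1"
    and b: "b \<in># B" "b' \<in># B" "b \<noteq> b'"
  shows "card (b \<inter> b') = lam"
proof -
  have V: "finite V" "card V = v" "size B = v"
    and blocks: "\<And>b. b \<in># B \<Longrightarrow> b \<subseteq> V \<and> card b = k"
    and pairs: "\<And>x y. x \<in> V \<Longrightarrow> y \<in> V \<Longrightarrow> x \<noteq> y \<Longrightarrow>
        size (filter_mset (\<lambda>b. x \<in> b \<and> y \<in> b) B) = lam"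
    using sym by (auto simp: symmetric_design_def design2_def)
  \<comment> \<open>Columns are indexed by list positions, so that repeated blocks count separately
    and there are exactly v columns.\<close>
  obtain bs where bs: "mset bs = B" using ex_mset by blast
  then have len: "length bs = v" using V(3) by auto
  have nth: "bs ! j \<in># B" if "j < v" for j using that bs len by auto
  obtain i j where ij: "i < v" "j < v" "b = bs ! i" "b' = bs ! j"
    using b bs len by (metis in_set_conv_nth set_mset_mset)
  define a where "a x j = (if x \<in> bs ! j then 1 else 0 :: int)" for x j
  have sum_a: "(\<Sum>x\<in>V. if x \<in> c then 1 else 0 :: int) = int (card c)" if "c \<subseteq> V" for c
    using that V(1) by (simp add: sum.If_cases Int_absorb1)
  have "(\<Sum>x\<in>V. a x i * a x j) = int lam"
  proof (rule incidence_columns_inner_product[where J = "{..<v}"])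
    fix j assume "j \<in> {..<v}"
    then show "(\<Sum>x\<in>V. a x j) = int k"
      unfolding a_def using blocks[OF nth] sum_a by auto
  next
    fix x y assume xy: "x \<in> V" "y \<in> V" "x \<noteq> y"
    have "(\<Sum>j\<in>{..<v}. a x j * a y j) = (\<Sum>j\<in>{..<v}. if x \<in> bs ! j \<and> y \<in> bs ! j then 1 else 0)"
      by (intro sum.cong) (auto simp: a_def)
    also have "\<dots> = int (card {j. j < v \<and> x \<in> bs ! j \<and> y \<in> bs ! j})"
      by (simp add: sum.If_cases Int_def)
    also have "\<dots> = int (length (filter (\<lambda>b. x \<in> b \<and> y \<in> b) bs))"
      by (simp add: length_filter_conv_card len)
    also have "\<dots> = int lam"
      using pairs[OF xy] by (metis bs mset_filter size_mset)
    finally show "(\<Sum>j\<in>{..<v}. a x j * a y j) = int lam" .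
  qed (use V k ij b(3) in \<open>auto simp: a_def\<close>)
  moreover have "(\<Sum>x\<in>V. a x i * a x j) = (\<Sum>x\<in>V. if x \<in> b \<inter> b' then 1 else 0)"
    by (intro sum.cong) (auto simp: a_def ij)
  moreover have "b \<inter> b' \<subseteq> V" using blocks b by blast
  ultimately have "int (card (b \<inter> b')) = int lam" using sum_a[of "b \<inter> b'"] by simp
  then show ?thesis by simp
qed

lemma symmetric_design_block_inter_mod:
  assumes sym: "symmetric_design V B v k lam" and v: "v \<ge> 2"
    and p: "prime p" "int p dvd int k - int lam"
    and b: "b \<in># B" "b' \<in># B"
  shows "int p dvd int (card (b \<inter> b')) - int lam"
proof (cases "b = b'")
  case True
  then show ?thesis using sym b p(2) by (auto simp: symmetric_design_def design2_def)
next
  case False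
  \<comment> \<open>Blocks of size 1 contain no two distinct points, so lam would be 0 and p would
    divide 1.\<close>
  have "k \<noteq> 1"
  proof
    assume "k = 1"
    then have blocks: "\<And>c. c \<in># B \<Longrightarrow> card c = 1"
      using sym by (auto simp: symmetric_design_def design2_def)
    have "finite V" "\<not> card V \<le> Suc 0"
      using v sym by (auto simp: symmetric_design_def design2_def)
    then obtain x y where xy: "x \<in> V" "y \<in> V" "x \<noteq> y"
      using card_le_Suc0_iff_eq by blast
    have "filter_mset (\<lambda>c. x \<in> c \<and> y \<in> c) B = {#}"
      using blocks xy(3) by (fastforce simp: card_1_singleton_iff)
    moreover have "size (filter_mset (\<lambda>c. x \<in> c \<and> y \<in> c) B) = lam"
      using sym xy by (simp add: symmetric_design_def design2_def)
    ultimately have "lam = 0" by (metis size_empty)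
    then show False using p \<open>k = 1\<close> by simp
  qed
  then show ?thesis using symmetric_design_block_inter[OF sym _ b False] by simp
qed

text \<open>\<open>e\<close> is a discrete logarithm along the cycle starting at
  \<open>x\<^sub>0\<close>: it identifies V with the integers modulo \<open>card V\<close> so that
  \<open>\<sigma>\<close> becomes addition of 1.\<close>

lemma transitive_cycle_labelling:
  assumes fin: "finite V" and bij: "bij_betw \<sigma> V V"
    and trans: "x\<^sub>0 \<in> V" "\<And>y. y \<in> V \<Longrightarrow> \<exists>n. (\<sigma> ^^ n) x\<^sub>0 = y"
  obtains e where "\<And>y z. y \<in> V \<Longrightarrow> z \<in> V \<Longrightarrow> [e y = e z] (mod card V) \<Longrightarrow> y = z"
    and "\<And>y g. y \<in> V \<Longrightarrow> [e ((\<sigma> ^^ g) y) = e y + g] (mod card V)"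
    and "\<And>z. z \<in> V \<Longrightarrow> bij_betw (\<lambda>g. (\<sigma> ^^ g) z) {..<card V} V"
proof -
  have bij_pow: "bij_betw (\<sigma> ^^ n) V V" for n by (rule bij_betw_funpow[OF bij])
  have in_V: "(\<sigma> ^^ n) y \<in> V" if "y \<in> V" for n y
    using bij_pow that by (rule bij_betw_apply)
  have shift: "(\<sigma> ^^ (b - a)) y = y" if "(\<sigma> ^^ a) y = (\<sigma> ^^ b) y" "a \<le> b" "y \<in> V" for a b y
  proof -
    have "(\<sigma> ^^ a) ((\<sigma> ^^ (b - a)) y) = (\<sigma> ^^ a) y"
      using that(1,2) by (metis comp_apply funpow_add le_add_diff_inverse)
    then show ?thesis
      using inj_onD[OF bij_betw_imp_inj_on[OF bij_pow]] in_V[OF that(3)] that(3) by blast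
  qed
  let ?o = "\<lambda>n. (\<sigma> ^^ n) x\<^sub>0"
  have "range ?o \<subseteq> V" using in_V[OF trans(1)] by blast
  then have "\<not> inj ?o" using finite_subset[OF _ fin] range_inj_infinite by blast
  then obtain m n where "m \<noteq> n" "?o m = ?o n" by (auto simp: inj_def)
  then obtain a b where "a < b" "?o a = ?o b" by (cases m n rule: linorder_cases) auto
  then have "\<exists>n. n > 0 \<and> ?o n = x\<^sub>0"
    using shift[of a x\<^sub>0 b] trans(1) by (intro exI[of _ "b - a"]) auto
  \<comment> \<open>The first return time turns out to be \<open>card V\<close>: the points before
    it are distinct and, by transitivity, exhaust V.\<close>
  define d where "d = (LEAST n. n > 0 \<and> ?o n = x\<^sub>0)"
  have d: "d > 0" "?o d = x\<^sub>0"
    using LeastI_ex[OF \<open>\<exists>n. n > 0 \<and> ?o n = x\<^sub>0\<close>] by (auto simp: d_def)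
  have least: "\<not> (n > 0 \<and> ?o n = x\<^sub>0)" if "n < d" for n
    using that not_less_Least unfolding d_def by blast
  have mod: "?o (n mod d) = ?o n" for n using d(2) by (rule funpow_mod_eq)
  have inj: "inj_on ?o {..<d}"
  proof (rule linorder_inj_onI')
    fix a b assume "a \<in> {..<d}" "b \<in> {..<d}" "a < b"
    then show "?o a \<noteq> ?o b"
      using shift[of a x\<^sub>0 b] trans(1) least[of "b - a"] by auto
  qed
  have "?o ` {..<d} = V"
  proof
    show "?o ` {..<d} \<subseteq> V" using in_V[OF trans(1)] by blast
    show "V \<subseteq> ?o ` {..<d}"
    proof
      fix y assume "y \<in> V"
      then obtain n where "y = ?o n" using trans(2) by metis
      then show "y \<in> ?o ` {..<d}" using mod[of n] d(1) by (metis imageI lessThan_iff mod_less_divisor)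
    qed
  qed
  then have "card V = d" using card_image[OF inj] by simp
  have o_eq: "?o m = ?o n \<longleftrightarrow> [m = n] (mod d)" for m n
  proof
    assume "?o m = ?o n"
    then have "?o (m mod d) = ?o (n mod d)" by (simp only: mod)
    then have "m mod d = n mod d" by (rule inj_onD[OF inj]) (use d(1) in auto)
    then show "[m = n] (mod d)" by (simp add: cong_def)
  next
    assume "[m = n] (mod d)"
    then have "?o (m mod d) = ?o (n mod d)" by (simp add: cong_def)
    then show "?o m = ?o n" by (simp only: mod)
  qed
  \<comment> \<open>Any exponent reaching y serves, as only its residue modulo \<open>d\<close>
    matters.\<close>
  define e where "e y = (SOME n. ?o n = y)" for y
  have e: "?o (e y) = y" if "y \<in> V" for y
    unfolding e_def using trans(2)[OF that] by (rule someI_ex)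
  have e_shift: "[e ((\<sigma> ^^ g) y) = e y + g] (mod d)" if "y \<in> V" for y g
  proof -
    have "?o (e ((\<sigma> ^^ g) y)) = (\<sigma> ^^ g) (?o (e y))" using e that in_V by simp
    also have "\<dots> = ?o (e y + g)" by (simp add: funpow_add add.commute)
    finally show ?thesis by (simp add: o_eq)
  qed
  have e_inj: "y = z" if "y \<in> V" "z \<in> V" "[e y = e z] (mod d)" for y z
    using that e o_eq by metis
  have "bij_betw (\<lambda>g. (\<sigma> ^^ g) z) {..<d} V" if z: "z \<in> V" for z
  proof -
    have "inj_on (\<lambda>g. (\<sigma> ^^ g) z) {..<d}"
    proof (rule inj_onI)
      fix g g' assume g: "g \<in> {..<d}" "g' \<in> {..<d}" "(\<sigma> ^^ g) z = (\<sigma> ^^ g') z"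
      then have "[e z + g = e z + g'] (mod d)"
        using e_shift[OF z] by (metis cong_sym cong_trans)
      then have "[g = g'] (mod d)" by (simp only: cong_add_lcancel_nat)
      then show "g = g'" using g(1,2) by (simp add: cong_def)
    qed
    moreover from this have "(\<lambda>g. (\<sigma> ^^ g) z) ` {..<d} = V"
      using in_V[OF z] \<open>card V = d\<close> by (intro card_subset_eq[OF fin]) (auto simp: card_image)
    ultimately show ?thesis by (simp add: bij_betw_def)
  qed
  then show thesis using that[of e] e_shift e_inj \<open>card V = d\<close> by simp
qed

section \<open>Character sums over blocks\<close>

context comm_ideal
begin

lemma power_cong_of_cong:
  assumes "x ^ v \<approx> 1" and "[a = b] (mod v)"
  shows "x ^ a \<approx> x ^ b"
proof -
  have *: "x ^ a \<approx> x ^ b" if "[a = b] (mod v)" "a \<le> b" for a b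
  proof -
    from that obtain q where "b = q * v + a"
      using cong_le_nat[of a b v] by (auto simp: cong_sym_eq[of a b])
    moreover have "x ^ a * 1 \<approx> x ^ a * (x ^ v) ^ q"
      using cong_ideal_power[OF assms(1), of q] by (intro cong_ideal_mult) (auto intro: cong_ideal_sym)
    ultimately show ?thesis by (simp add: power_add mult.commute[of q] power_mult mult.commute[of "x ^ a"])
  qed
  show ?thesis
    using assms(2) *[of a b] *[of b a] by (metis cong_sym cong_ideal_sym nat_le_linear)
qed

text \<open>The factor \<open>v - 1\<close> acts as -1 on exponents, so a pair (y, z) contributes x
  to the difference of the labels. The difference is g exactly when y =
  \<open>(\<sigma> ^^ g) z\<close>, and the intersection counts these pairs.\<close>

lemma character_product_eq_intersection_sum:
  assumes fin: "finite V" and bij: "bij_betw \<sigma> V V" and v: "v > 0" "x ^ v \<approx> 1"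
    and e: "\<And>y g. y \<in> V \<Longrightarrow> [e ((\<sigma> ^^ g) y) = e y + g] (mod v)"
    and orbit: "\<And>z. z \<in> V \<Longrightarrow> bij_betw (\<lambda>g. (\<sigma> ^^ g) z) {..<v} V"
    and b: "b \<subseteq> V" "b' \<subseteq> V"
  shows "(\<Sum>y\<in>b. x ^ e y) * (\<Sum>z\<in>b'. x ^ ((v - 1) * e z)) \<approx>
    (\<Sum>g<v. of_nat (card (b \<inter> (\<sigma> ^^ g) ` b')) * x ^ g)"
proof -
  have "(\<Sum>y\<in>b. x ^ e y) * (\<Sum>z\<in>b'. x ^ ((v - 1) * e z)) =
      (\<Sum>z\<in>b'. \<Sum>y\<in>b. x ^ (e y + (v - 1) * e z))"
    by (subst sum.swap) (simp add: sum_product power_add)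
  also have "\<dots> \<approx> (\<Sum>z\<in>b'. \<Sum>g<v. if (\<sigma> ^^ g) z \<in> b then x ^ g else 0)"
  proof (rule cong_ideal_sum)
    fix z assume "z \<in> b'"
    then have z: "z \<in> V" using b by blast
    have "(\<Sum>y\<in>b. x ^ (e y + (v - 1) * e z)) =
        (\<Sum>y\<in>V. if y \<in> b then x ^ (e y + (v - 1) * e z) else 0)"
      using fin b(1) by (simp add: sum.If_cases Int_absorb1)
    also have "\<dots> = (\<Sum>g<v. if (\<sigma> ^^ g) z \<in> b then x ^ (e ((\<sigma> ^^ g) z) + (v - 1) * e z) else 0)"
      by (rule sum.reindex_bij_betw[OF orbit[OF z], symmetric])
    also have "\<dots> \<approx> (\<Sum>g<v. if (\<sigma> ^^ g) z \<in> b then x ^ g else 0)"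
    proof (rule cong_ideal_sum)
      fix g
      have "[e ((\<sigma> ^^ g) z) + (v - 1) * e z = (e z + g) + (v - 1) * e z] (mod v)"
        by (intro cong_add e z cong_refl)
      also have "(e z + g) + (v - 1) * e z = g + v * e z"
        using v(1) by (cases v) auto
      also have "[g + v * e z = g] (mod v)" by (simp add: cong_def)
      finally show "(if (\<sigma> ^^ g) z \<in> b then x ^ (e ((\<sigma> ^^ g) z) + (v - 1) * e z) else 0) \<approx>
          (if (\<sigma> ^^ g) z \<in> b then x ^ g else 0)"
        using power_cong_of_cong[OF v(2)] by auto
    qed
    finally show "(\<Sum>y\<in>b. x ^ (e y + (v - 1) * e z)) \<approx>
        (\<Sum>g<v. if (\<sigma> ^^ g) z \<in> b then x ^ g else 0)" .
  qed
  also have "(\<Sum>z\<in>b'. \<Sum>g<v. if (\<sigma> ^^ g) z \<in> b then x ^ g else 0) =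
      (\<Sum>g<v. \<Sum>z\<in>b'. if (\<sigma> ^^ g) z \<in> b then x ^ g else 0)"
    by (rule sum.swap)
  also have "\<dots> = (\<Sum>g<v. of_nat (card (b \<inter> (\<sigma> ^^ g) ` b')) * x ^ g)"
  proof (intro sum.cong refl)
    fix g
    have "inj_on (\<sigma> ^^ g) V" using bij_betw_funpow[OF bij] by (rule bij_betw_imp_inj_on)
    then have "card ((\<sigma> ^^ g) ` {z \<in> b'. (\<sigma> ^^ g) z \<in> b}) = card {z \<in> b'. (\<sigma> ^^ g) z \<in> b}"
      using b(2) by (intro card_image) (auto intro: inj_on_subset)
    moreover have "(\<sigma> ^^ g) ` {z \<in> b'. (\<sigma> ^^ g) z \<in> b} = b \<inter> (\<sigma> ^^ g) ` b'" by blast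
    moreover have "finite b'" using fin b(2) by (rule rev_finite_subset)
    ultimately show "(\<Sum>z\<in>b'. if (\<sigma> ^^ g) z \<in> b then x ^ g else 0) =
        of_nat (card (b \<inter> (\<sigma> ^^ g) ` b')) * x ^ g"
      by (simp add: sum.If_cases Int_def conj_commute)
  qed
  finally show ?thesis .
qed

end

section \<open>From vanishing sums of powers to an additive map\<close>

context comm_prime_ideal
begin

text \<open>No power of x lies in the prime ideal, so the smaller power can be cancelled.\<close>

lemma power_cong_iff_cong:
  assumes "v > 0" and ord: "\<And>i. x ^ i \<approx> 1 \<longleftrightarrow> v dvd i"
  shows "x ^ a \<approx> x ^ b \<longleftrightarrow> [a = b] (mod v)"
proof
  have xv: "x ^ v \<approx> 1" by (simp add: ord)
  have unit: "x ^ a \<notin> I" for a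
  proof
    assume "x ^ a \<in> I"
    then have "x ^ (a * v) \<in> I"
      unfolding power_mult power_eq_if[of _ v] using \<open>v > 0\<close> by (simp add: mult_mem_right)
    moreover have "x ^ (a * v) \<approx> 1" by (simp add: ord)
    ultimately show False using cong_ideal_mem_iff one_notin by blast
  qed
  have *: "[a = b] (mod v)" if "x ^ a \<approx> x ^ b" "a \<le> b" for a b
  proof -
    have "x ^ b = x ^ a * x ^ (b - a)" using that(2) by (simp flip: power_add)
    then have "x ^ a * (x ^ (b - a) - 1) \<in> I"
      using that(1) cong_ideal_sym[OF that(1)] by (simp add: cong_ideal_def algebra_simps)
    then have "x ^ (b - a) \<approx> 1" using unit prime_mem by (auto simp: cong_ideal_def)
    then show ?thesis using ord that(2) by (simp add: cong_altdef_nat cong_sym_eq[of a b])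
  qed
  show "[a = b] (mod v)" if "x ^ a \<approx> x ^ b"
    using that *[of a b] *[of b a] by (metis cong_sym cong_ideal_sym nat_le_linear)
  show "x ^ a \<approx> x ^ b" if "[a = b] (mod v)"
    using power_cong_of_cong[OF xv that] .
qed

text \<open>A point y is sent to the coordinates of x^(h y). They determine this power, hence
  \<open>h y\<close> modulo v, hence y; and by independence a sum of powers in \<open>I\<close> has
  all coordinates divisible by p.\<close>

lemma additive_EA_of_powers:
  assumes v: "v > 0" and ord: "\<And>i. x ^ i \<approx> 1 \<longleftrightarrow> v dvd i"
    and p: "prime p" "\<not> p dvd v" "of_nat p \<in> I"
    and inj: "\<And>y z. y \<in> V \<Longrightarrow> z \<in> V \<Longrightarrow> [h y = h z] (mod v) \<Longrightarrow> y = z"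
    and blocks: "\<And>b. b \<in># B \<Longrightarrow> (\<Sum>y\<in>b. x ^ h y) \<in> I"
  shows "additive_EA V B p (ord v p)"
proof -
  let ?t = "Pocklington.ord v p"
  have "coprime v p" using p by (simp add: prime_imp_coprime coprime_commute)
  then have t: "?t > 0" by simp
  have xv: "x ^ v \<approx> 1" by (simp add: ord)
  \<comment> \<open>By definition of the order, p^t is 1 modulo v.\<close>
  have "x ^ (p ^ ?t) \<approx> x ^ 1"
    by (rule power_cong_of_cong[OF xv Pocklington.ord])
  then have xt: "x ^ (p ^ ?t) \<approx> x" by simp
  obtain d c where d: "d \<le> ?t" and c: "\<And>n. c n \<in> EA_carrier p d"
    "\<And>n. x ^ n \<approx> (\<Sum>i<d. of_int (c n i) * x ^ i)"
    and indep: "\<And>e i. (\<Sum>i<d. of_int (e i) * x ^ i) \<in> I \<Longrightarrow> i < d \<Longrightarrow> int p dvd e i"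
    using power_coordinates[OF p(1,3) v xv t xt] by blast
  let ?f = "\<lambda>y. c (h y)"
  have "EA_carrier p d \<subseteq> EA_carrier p ?t"
  proof
    fix g assume "g \<in> EA_carrier p d"
    then show "g \<in> EA_carrier p ?t"
      using d prime_gt_0_nat[OF p(1)] unfolding EA_carrier_def
      by clarsimp (metis not_le order_refl of_nat_0_less_iff order_trans)
  qed
  then have "?f ` V \<subseteq> EA_carrier p ?t" using c(1) by blast
  moreover have "inj_on ?f V"
  proof (rule inj_onI)
    fix y z assume yz: "y \<in> V" "z \<in> V" "c (h y) = c (h z)"
    then have "x ^ h y \<approx> x ^ h z" using c(2) by (metis cong_ideal_sym cong_ideal_trans)
    then show "y = z" using inj yz power_cong_iff_cong[OF v ord] by blast
  qed
  moreover have "(\<Sum>y\<in>b. ?f y i) mod int p = 0" if b: "b \<in># B" for b i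
  proof (cases "i < d")
    case True
    have "(\<Sum>y\<in>b. x ^ h y) \<approx> (\<Sum>y\<in>b. \<Sum>i<d. of_int (c (h y) i) * x ^ i)"
      by (intro cong_ideal_sum c(2))
    also have "\<dots> = (\<Sum>i<d. of_int (\<Sum>y\<in>b. c (h y) i) * x ^ i)"
      by (subst sum.swap) (simp add: sum_distrib_right)
    finally have "(\<Sum>i<d. of_int (\<Sum>y\<in>b. c (h y) i) * x ^ i) \<in> I"
      using blocks[OF b] cong_ideal_mem_iff by blast
    then have "int p dvd (\<Sum>y\<in>b. c (h y) i)" by (rule indep[of "\<lambda>i. \<Sum>y\<in>b. c (h y) i", OF _ True])
    then show ?thesis by simp
  next
    case False
    then show ?thesis using c(1) by (simp add: EA_carrier_def)
  qed
  ultimately show ?thesis unfolding additive_EA_def by blast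
qed

end

section \<open>Vanishing of the character or of its inverse on all blocks\<close>

theorem theorem3p1:
  fixes V :: "'a set" and B :: "'a set multiset" and v k lam p :: nat
  assumes "symmetric_design V B v k lam"
    and "cyclic_design V B"
    and "prime p"
    and "int p dvd int k - int lam"
    and "\<not> p dvd v"
  shows "additive_EA V B p (ord v p)"
proof -
  have V: "finite V" "card V = v" and blocks: "\<And>b. b \<in># B \<Longrightarrow> b \<subseteq> V"
    using assms(1) by (auto simp: symmetric_design_def design2_def)
  obtain \<sigma> x\<^sub>0 where \<sigma>: "bij_betw \<sigma> V V" "x\<^sub>0 \<in> V" "\<And>y. y \<in> V \<Longrightarrow> \<exists>n. (\<sigma> ^^ n) x\<^sub>0 = y"
    and inv: "image_mset (\<lambda>b. \<sigma> ` b) B = B"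
    using assms(2) unfolding cyclic_design_def by metis
  have "v > 0" using V \<sigma>(2) card_gt_0_iff by blast
  show ?thesis
  proof (cases "v = 1")
    case True
    \<comment> \<open>On a single point the zero map is injective. The general argument needs x - 1
      outside \<open>I\<close>, that is, v > 1.\<close>
    then obtain y where "V = {y}" using V(2) by (auto simp: card_1_singleton_iff)
    then show ?thesis
      using prime_gt_0_nat[OF assms(3)]
      by (auto simp: additive_EA_def EA_carrier_def intro!: exI[of _ "\<lambda>_ _. 0"])
  next
    case False
    then have "v \<ge> 2" using \<open>v > 0\<close> by simp
    obtain e where e_inj: "\<And>y z. y \<in> V \<Longrightarrow> z \<in> V \<Longrightarrow> [e y = e z] (mod v) \<Longrightarrow> y = z"
      and e_shift: "\<And>y g. y \<in> V \<Longrightarrow> [e ((\<sigma> ^^ g) y) = e y + g] (mod v)"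
      and orbit: "\<And>z. z \<in> V \<Longrightarrow> bij_betw (\<lambda>g. (\<sigma> ^^ g) z) {..<v} V"
      using transitive_cycle_labelling[OF V(1) \<sigma>] V(2) by metis
    obtain I and x :: "int poly" where "comm_prime_ideal I" and p_mem: "of_nat p \<in> I"
      and order: "\<And>i. x ^ i - 1 \<in> I \<longleftrightarrow> v dvd i"
      using ex_prime_ideal_primitive_root[OF \<open>v > 0\<close> assms(3,5)] by blast
    interpret comm_prime_ideal I by fact
    have order': "cong_ideal (x ^ i) 1 \<longleftrightarrow> v dvd i" for i
      by (simp add: cong_ideal_def order)
    \<comment> \<open>The full sum of the character vanishes because x - 1 can be cancelled modulo
      \<open>I\<close>.\<close>
    have "(x - 1) * (\<Sum>g<v. x ^ g) = x ^ v - 1" by (simp add: power_diff_1_eq)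
    then have "(x - 1) * (\<Sum>g<v. x ^ g) \<in> I" by (simp add: order)
    moreover have "x - 1 \<notin> I" using order[of 1] \<open>v \<ge> 2\<close> by simp
    ultimately have geom: "(\<Sum>g<v. x ^ g) \<in> I" using prime_mem by blast
    have block_pow: "(\<sigma> ^^ g) ` b \<in># B" if "b \<in># B" for b g
    proof (induction g)
      case (Suc g)
      then have "\<sigma> ` (\<sigma> ^^ g) ` b \<in># image_mset (\<lambda>b. \<sigma> ` b) B" by simp
      then show ?case by (simp add: inv image_comp)
    qed (use that in simp)
    \<comment> \<open>Replacing every intersection size by lam changes the sum by an element of
      \<open>I\<close> and leaves a multiple of the geometric sum.\<close>
    have prod: "(\<Sum>y\<in>b. x ^ e y) * (\<Sum>z\<in>b'. x ^ ((v - 1) * e z)) \<in> I"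
      if b: "b \<in># B" "b' \<in># B" for b b'
    proof -
      have "of_int (int (card (b \<inter> (\<sigma> ^^ g) ` b')) - int lam) \<in> I" for g
        using symmetric_design_block_inter_mod[OF assms(1) \<open>v \<ge> 2\<close> assms(3,4) b(1) block_pow[OF b(2)]]
        by (rule of_int_dvd_mem[rotated]) (use p_mem in simp)
      then have "(\<Sum>g<v. of_int (int (card (b \<inter> (\<sigma> ^^ g) ` b')) - int lam) * x ^ g) \<in> I"
        by (intro sum_mem mult_mem_right)
      then have "(\<Sum>g<v. of_int (int (card (b \<inter> (\<sigma> ^^ g) ` b')) - int lam) * x ^ g)
          + of_nat lam * (\<Sum>g<v. x ^ g) \<in> I"
        using geom add_mem mult_mem by blast
      also have "(\<Sum>g<v. of_int (int (card (b \<inter> (\<sigma> ^^ g) ` b')) - int lam) * x ^ g)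
          + of_nat lam * (\<Sum>g<v. x ^ g) = (\<Sum>g<v. of_nat (card (b \<inter> (\<sigma> ^^ g) ` b')) * x ^ g)"
        by (simp add: left_diff_distrib sum_subtractf sum_distrib_left)
      finally show ?thesis
        using character_product_eq_intersection_sum[OF V(1) \<sigma>(1) \<open>v > 0\<close> _ e_shift orbit
            blocks[OF b(1)] blocks[OF b(2)], of x] order'[of v] cong_ideal_mem_iff by simp
    qed
    show ?thesis
    proof (cases "\<forall>b\<in>#B. (\<Sum>y\<in>b. x ^ e y) \<in> I")
      case True
      then show ?thesis
        using additive_EA_of_powers[OF \<open>v > 0\<close> order' assms(3,5) p_mem e_inj, where V = V and B = B] by blast
    next
      case False
      \<comment> \<open>Some block has a character sum outside \<open>I\<close>; pairing it with an
        arbitrary block, primality makes the inverse character vanish on the latter.\<close>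
      then have vanish: "(\<Sum>z\<in>b. x ^ ((v - 1) * e z)) \<in> I" if "b \<in># B" for b
        using prod prime_mem that by blast
      \<comment> \<open>Hence multiplying the labels by \<open>v - 1\<close> keeps them distinct
        modulo v.\<close>
      have "coprime (v - 1) v" using \<open>v > 0\<close> by (metis coprime_diff_one_left_nat)
      then have "y = z" if "y \<in> V" "z \<in> V" "[(v - 1) * e y = (v - 1) * e z] (mod v)" for y z
        using that e_inj cong_mult_lcancel_nat by blast
      then show ?thesis
        using additive_EA_of_powers[OF \<open>v > 0\<close> order' assms(3,5) p_mem, where V = V and B = B and h = "\<lambda>y. (v - 1) * e y"] vanish
        by blast
    qed
  qed
qed

end
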